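(* Let $d\in\mathbb N$ and let $(c_n)_{n\ge 1}$ be a sequence of positive real numbers such that for every permutation $(c'_n)$ of $(c_n)$ the sequence $(\sqrt[d]{n}/c'_n)_{n\ge1}$ is unbounded. Then there exist a sequence $(b_n)_{n\ge1}$ of positive real numbers and a continuous, nonnegative, Lebesgue integrable function $f:\mathbb R^d\to\mathbb R$ such that $b_n/c_n\to1$ as $n\to\infty$ and, for every $x\in\mathbb R^d$, the sequence $(f(b_nx))_{n\ge1}$ does not converge to $0$.
   Context: $\mathbb N=\{1,2,3,\dots\}$; integrability is with respect to the $d$-dimensional Lebesgue measure. A permutation of a sequence $(c_n)_{n\ge1}$ is a sequence $(c'_n)_{n\ge1}$ of the form $c'_n=c_{\sigma(n)}$ for a bijection $\sigma:\mathbb N\to\mathbb N$. *)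

theory Defs
  imports "HOL-Analysis.Analysis"
begin

text \<open>Sequences indexed by the positive integers are functions on \<^typ>\<open>nat\<close> whose value
  at \<open>0\<close> is irrelevant; hence permutations are bijections of \<open>{1..}\<close>, not of
  all of \<^typ>\<open>nat\<close>.\<close>

definition is_permutation_of :: "(nat \<Rightarrow> 'a) \<Rightarrow> (nat \<Rightarrow> 'a) \<Rightarrow> bool" where
  "is_permutation_of c' c \<longleftrightarrow>
     (\<exists>\<sigma>. bij_betw \<sigma> {1::nat..} {1::nat..} \<and> (\<forall>n\<ge>1. c' n = c (\<sigma> n)))"

end

theory Submission
  imports Defs
begin

text \<open>Write \<open>N R\<close> for the number of indices \<open>n\<close> with \<open>c n \<le> R\<close>.

If some \<open>N R\<close> is infinite, then \<open>b = c\<close> works with any positive continuous integrable \<open>f\<close>: infinitely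
many of the points \<open>c n *\<^sub>R x\<close> lie in one compact ball, on which \<open>f\<close> is bounded away from \<open>0\<close>.

Otherwise \<open>c\<close> tends to infinity and can be sorted. For the sorted sequence, boundedness of
\<open>root d n / c' n\<close> amounts to \<open>N R \<le> C * R ^ d\<close>, so the hypothesis says that \<open>N R / R ^ d\<close> is unbounded
(\<open>bounded_permutation_if_sublevel_growth\<close>). Splitting \<open>(0, R]\<close> geometrically, some short interval
\<open>(T / q, T]\<close> with fixed ratio \<open>q = 1 + \<epsilon>\<close> must by itself contain at least \<open>M * T ^ d\<close> terms of \<open>c\<close>, with
\<open>M\<close> and \<open>T\<close> as large as desired (\<open>crowded_ratio_interval\<close>). These \<open>m \<ge> M * T ^ d\<close> terms may be moved
freely inside the interval, since this changes them only by a factor between \<open>1 / q\<close> and \<open>q\<close>. If they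
are spread evenly, then for every \<open>x\<close> with \<open>\<rho> \<le> norm x < \<rho> * q\<close> one of them brings \<open>x\<close> into the spherical
shell of radius \<open>T * \<rho>\<close> whose relative thickness is only of order \<open>\<epsilon> / m\<close>. That shell has volume of order
\<open>(T * \<rho>) ^ d * \<epsilon> / m \<le> \<rho> ^ d * \<epsilon> / M\<close>, which is as small as desired. A radial function made of finitely
many tents over such shells therefore has small integral and is at least \<open>1\<close> at some \<open>b n *\<^sub>R x\<close> for each
\<open>x\<close> in a prescribed annulus (\<open>catching_block_exists\<close>).

Doing this on successive disjoint blocks of indices, with \<open>\<epsilon>\<close> and the integrals tending to \<open>0\<close> and the
annuli exhausting the punctured space, and summing the radial functions gives \<open>b\<close> and \<open>f\<close>; a positive
function added to the sum takes care of \<open>x = 0\<close> (\<open>assemble_catching_blocks\<close>).\<close>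

section \<open>Positive continuous integrable functions\<close>

text \<open>Such a function serves for sequences with a bounded subsequence, and makes \<open>f 0\<close> positive in the other
case. It is a sum of tents over growing balls, weighted so that both their heights and their integrals
are dominated by a geometric series.\<close>

lemma positive_continuous_integrable_exists:
  "\<exists>f :: 'a::euclidean_space \<Rightarrow> real. continuous_on UNIV f \<and> (\<forall>x. 0 < f x) \<and> integrable lborel f"
proof -
  define V where "V k = measure lborel (cball (0::'a) (real k + 1))" for k
  define h where "h k x = (1/2)^k / (1 + V k) * max 0 (1 - norm x / (real k + 1))" for k and x :: 'a
  have V0: "0 \<le> V k" for k
    by (simp add: V_def)
  have h0: "0 \<le> h k x" for k x
    by (simp add: h_def V0)
  have h_bound: "h k x \<le> (1/2)^k / (1 + V k) * indicator (cball 0 (real k + 1)) x" for k x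
  proof (cases "norm x \<le> real k + 1")
    case True
    have "(1/2::real)^k / (1 + V k) * max 0 (1 - norm x / (real k + 1)) \<le> (1/2)^k / (1 + V k) * 1"
      using V0[of k] by (intro mult_left_mono) auto
    then show ?thesis using True by (simp add: h_def)
  next
    case False
    then have "1 \<le> norm x / (real k + 1)" by (simp add: field_simps)
    with False show ?thesis by (simp add: h_def)
  qed
  have h_le: "h k x \<le> (1/2)^k" for k x
  proof -
    have "(1/2)^k / (1 + V k) \<le> (1/2::real)^k / 1"
      using V0[of k] by (intro divide_left_mono) auto
    moreover have "h k x \<le> (1/2)^k / (1 + V k)"
      using h_bound[of k x] V0[of k] by (auto simp: indicator_def split: if_splits intro: order_trans)
    ultimately show ?thesis by simp
  qed
  have h_cont: "continuous_on UNIV (h k)" for k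
    unfolding h_def by (intro continuous_intros) auto
  have h_meas: "h k \<in> borel_measurable lborel" for k
    using borel_measurable_continuous_onI[OF h_cont[of k]] by simp
  have ball_int: "integrable lborel (\<lambda>x::'a. (1/2)^k / (1 + V k) * indicator (cball 0 (real k + 1)) x)" for k
    using emeasure_lborel_cball_finite[of "0::'a" "real k + 1"]
    by (intro integrable_mult_right integrable_real_indicator) auto
  have h_int: "integrable lborel (h k)" for k
    by (rule Bochner_Integration.integrable_bound[OF ball_int[of k] h_meas])
      (use h0[of k] h_bound[of k] V0[of k] in auto)
  have h_integral: "integral\<^sup>L lborel (h k) \<le> (1/2)^k" for k
  proof -
    have "integral\<^sup>L lborel (h k) \<le> integral\<^sup>L lborel (\<lambda>x::'a. (1/2)^k / (1 + V k) * indicator (cball 0 (real k + 1)) x)"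
      by (intro integral_mono h_int ball_int h_bound)
    also have "\<dots> = (1/2)^k / (1 + V k) * V k"
      by (simp add: V_def)
    also have "\<dots> = (1/2)^k * (V k / (1 + V k))" by simp
    also have "\<dots> \<le> (1/2)^k * 1"
      using V0[of k] by (intro mult_left_mono) auto
    also have "\<dots> = (1/2)^k" by simp
    finally show ?thesis .
  qed
  have half: "summable (\<lambda>k. (1/2::real)^k)" by (simp add: summable_geometric)
  have summ: "summable (\<lambda>k. h k x)" for x
    by (rule summable_comparison_test'[OF half, of 0]) (use h0 h_le in auto)
  let ?f = "\<lambda>x. \<Sum>k. h k x"
  have "continuous_on UNIV ?f"
  proof (rule uniform_limit_theorem)
    show "uniform_limit UNIV (\<lambda>n x. \<Sum>k<n. h k x) ?f sequentially"
      by (rule Weierstrass_m_test[OF _ half]) (use h0 h_le in auto)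
  qed (auto intro!: always_eventually continuous_on_sum h_cont)
  moreover have "0 < ?f x" for x
  proof -
    obtain k where "norm x < real k" using reals_Archimedean2 by blast
    then have "norm x / (real k + 1) < 1" by (simp add: field_simps)
    then have "0 < h k x" using V0[of k] by (simp add: h_def)
    with summ h0 show ?thesis by (rule suminf_pos2)
  qed
  moreover have "integrable lborel ?f"
  proof (rule integrable_suminf[OF h_int])
    show "AE x in lborel. summable (\<lambda>k. norm (h k x))" using summ h0 by auto
    show "summable (\<lambda>k. \<integral>x. norm (h k x) \<partial>lborel)"
      by (rule summable_comparison_test'[OF half, of 0]) (use h0 h_integral in \<open>auto simp: integral_nonneg_AE\<close>)
  qed
  ultimately show ?thesis by blast
qed

section \<open>Sorting and counting\<close>

text \<open>The permutation lists the terms in increasing order, ties being broken by the index. It is obtained as the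
inverse of the rank \<open>card (P n)\<close>, where \<open>P n\<close> consists of \<open>n\<close> and its predecessors in that order. The rank
is onto because it maps each \<open>P n\<close> injectively into, hence onto, an initial segment of equal cardinality,
and these segments are arbitrarily long because an injective rank is unbounded.\<close>

lemma sublevel_ranking:
  fixes c :: "nat \<Rightarrow> real"
  assumes fin: "\<And>R. finite {n. 1 \<le> n \<and> c n \<le> R}"
  obtains \<sigma> where "bij_betw \<sigma> {1::nat..} {1..}"
    and "\<And>n. 1 \<le> n \<Longrightarrow> n \<le> card {m. 1 \<le> m \<and> c m \<le> c (\<sigma> n)}"
proof -
  define P where "P n = {m. 1 \<le> m \<and> (c m < c n \<or> c m = c n \<and> m \<le> n)}" for n
  have Psub: "P n \<subseteq> {m. 1 \<le> m \<and> c m \<le> c n}" for n by (auto simp: P_def)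
  have finP: "finite (P n)" for n using finite_subset[OF Psub fin] .
  have self: "n \<in> P n" if "1 \<le> n" for n using that by (simp add: P_def)
  have strict: "card (P m) < card (P n)" if "1 \<le> n" "c m < c n \<or> c m = c n \<and> m < n" for m n
  proof (rule psubset_card_mono[OF finP])
    have "n \<notin> P m" using that by (auto simp: P_def)
    moreover have "P m \<subseteq> P n" using that by (auto simp: P_def)
    ultimately show "P m \<subset> P n" using self that by blast
  qed
  have inj: "inj_on (\<lambda>n. card (P n)) {1..}"
  proof (rule inj_onI)
    fix m n :: nat assume "m \<in> {1..}" "n \<in> {1..}" "card (P m) = card (P n)"
    then show "m = n" using strict[of n m] strict[of m n]
      by (cases "c m < c n"; cases "c n < c m"; cases m n rule: linorder_cases) auto
  qed
  have pos: "1 \<le> card (P n)" if "1 \<le> n" for n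
    using self[OF that] finP[of n] by (auto simp: Suc_le_eq card_gt_0_iff)
  have initial: "(\<lambda>n. card (P n)) ` P n = {1..card (P n)}" for n
  proof (rule card_subset_eq)
    show "(\<lambda>n. card (P n)) ` P n \<subseteq> {1..card (P n)}"
    proof
      fix k assume "k \<in> (\<lambda>n. card (P n)) ` P n"
      then obtain m where m: "m \<in> P n" "k = card (P m)" by blast
      then have "P m \<subseteq> P n" by (auto simp: P_def)
      then have "card (P m) \<le> card (P n)" by (intro card_mono finP)
      moreover have "1 \<le> card (P m)" using m by (intro pos) (auto simp: P_def)
      ultimately show "k \<in> {1..card (P n)}" using m by simp
    qed
    have "inj_on (\<lambda>n. card (P n)) (P n)"
      by (rule inj_on_subset[OF inj]) (auto simp: P_def)
    then show "card ((\<lambda>n. card (P n)) ` P n) = card {1..card (P n)}"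
      by (simp add: card_image)
  qed simp
  have "bij_betw (\<lambda>n. card (P n)) {1..} {1..}"
  proof (unfold bij_betw_def, intro conjI inj equalityI subsetI)
    fix k assume "k \<in> (\<lambda>n. card (P n)) ` {1..}"
    then show "k \<in> {1..}" using pos by auto
  next
    fix k :: nat assume k: "k \<in> {1..}"
    have "infinite ((\<lambda>n. card (P n)) ` {1..})"
      using inj by (simp add: finite_image_iff infinite_Ici)
    then obtain n where "k \<le> card (P n)"
      by (auto simp: infinite_nat_iff_unbounded_le)
    then have "k \<in> (\<lambda>n. card (P n)) ` P n" using k initial[of n] by simp
    then show "k \<in> (\<lambda>n. card (P n)) ` {1..}" by (auto simp: P_def)
  qed
  note bij = this
  show ?thesis
  proof (rule that)
    show bs: "bij_betw (inv_into {1..} (\<lambda>n. card (P n))) {1::nat..} {1..}"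
      using bij by (rule bij_betw_inv_into)
    fix n :: nat assume n: "1 \<le> n"
    let ?s = "inv_into {1..} (\<lambda>n. card (P n)) n"
    have "n = card (P ?s)"
      using bij_betw_inv_into_right[OF bij, of n] n by simp
    also have "\<dots> \<le> card {m. 1 \<le> m \<and> c m \<le> c ?s}"
      by (rule card_mono[OF fin Psub])
    finally show "n \<le> card {m. 1 \<le> m \<and> c m \<le> c ?s}" .
  qed
qed

text \<open>In sorted order, the rank of a term is at most the number of terms that do not exceed it, so polynomial
growth of this number bounds the \<open>d\<close>-th root of the rank by a multiple of the term.\<close>

lemma bounded_permutation_if_sublevel_growth:
  fixes c :: "nat \<Rightarrow> real"
  assumes d: "0 < d" and c_pos: "\<And>n. 1 \<le> n \<Longrightarrow> 0 < c n"
    and fin: "\<And>R. finite {n. 1 \<le> n \<and> c n \<le> R}"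
    and growth: "\<And>n. 1 \<le> n \<Longrightarrow> real (card {m. 1 \<le> m \<and> c m \<le> c n}) \<le> C * c n ^ d"
  shows "\<exists>c'. is_permutation_of c' c \<and> bounded ((\<lambda>n. root d (real n) / c' n) ` {1..})"
proof -
  obtain \<sigma> where \<sigma>: "bij_betw \<sigma> {1::nat..} {1..}"
    "\<And>n. 1 \<le> n \<Longrightarrow> n \<le> card {m. 1 \<le> m \<and> c m \<le> c (\<sigma> n)}"
    using sublevel_ranking[OF fin] by blast
  have "is_permutation_of (c \<circ> \<sigma>) c" using \<sigma>(1) by (auto simp: is_permutation_of_def)
  moreover have "bounded ((\<lambda>n. root d (real n) / (c \<circ> \<sigma>) n) ` {1..})"
  proof (unfold bounded_iff, intro exI[of _ "root d C"] ballI)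
    fix y assume "y \<in> (\<lambda>n. root d (real n) / (c \<circ> \<sigma>) n) ` {1..}"
    then obtain n where n: "1 \<le> n" and y: "y = root d (real n) / c (\<sigma> n)" by auto
    have s: "1 \<le> \<sigma> n" using bij_betwE[OF \<sigma>(1)] n by auto
    then have p: "0 < c (\<sigma> n)" by (rule c_pos)
    have "real n \<le> C * c (\<sigma> n) ^ d" using growth[OF s] \<sigma>(2)[OF n] by linarith
    then have "root d (real n) \<le> root d (C * c (\<sigma> n) ^ d)" using d by simp
    also have "\<dots> = root d C * c (\<sigma> n)" using d p by (simp add: real_root_mult real_root_power_cancel)
    finally have "y \<le> root d C" using p by (simp add: y field_simps)
    moreover have "0 \<le> y" using p d by (simp add: y)
    ultimately show "norm y \<le> root d C" by simp
  qed
  ultimately show ?thesis by blast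
qed

text \<open>If every interval \<open>(T / q, T]\<close> with \<open>T \<ge> R\<close> contained at most \<open>M * T ^ d\<close> terms, then adding up the
intervals \<open>(T / q ^ (j + 1), T / q ^ j]\<close>, whose counts are dominated by a geometric series of ratio
\<open>1 / q ^ d\<close>, would bound the number of all terms up to \<open>T\<close> by a multiple of \<open>T ^ d\<close>.\<close>

lemma crowded_ratio_interval:
  fixes c :: "nat \<Rightarrow> real"
  assumes d: "0 < d" and c_pos: "\<And>n. 1 \<le> n \<Longrightarrow> 0 < c n"
    and fin: "\<And>R. finite {n. 1 \<le> n \<and> c n \<le> R}"
    and growth: "\<And>C. \<exists>n\<ge>1. C * c n ^ d < real (card {m. 1 \<le> m \<and> c m \<le> c n})"
    and q: "1 < q" and R: "0 < R" and M: "0 \<le> M"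
  obtains T where "R \<le> T" and "M * T ^ d < real (card {n. p \<le> n \<and> 1 \<le> n \<and> T / q < c n \<and> c n \<le> T})"
proof -
  have "\<exists>T\<ge>R. M * T ^ d < real (card {n. p \<le> n \<and> 1 \<le> n \<and> T / q < c n \<and> c n \<le> T})"
  proof (rule ccontr)
    assume "\<not> ?thesis"
    then have sparse: "real (card {n. p \<le> n \<and> 1 \<le> n \<and> T / q < c n \<and> c n \<le> T}) \<le> M * T ^ d" if "R \<le> T" for T
      using that by (auto simp: not_less)
    define N where "N T = {n. p \<le> n \<and> 1 \<le> n \<and> R < c n \<and> c n \<le> T}" for T
    \<comment> \<open>\<open>B\<close> is the value of the geometric series, that is, the fixed point of \<open>B \<mapsto> B / q ^ d + M\<close>.\<close>
    define B where "B = M * q ^ d / (q ^ d - 1)"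
    have qd: "1 < q ^ d" using q d by (simp add: one_less_power)
    have "B * (q ^ d - 1) = M * q ^ d" using qd by (simp add: B_def)
    then have "(B - M) * q ^ d = B" by (simp add: algebra_simps)
    then have "B / q ^ d = B - M" using q by (auto simp: divide_eq_eq)
    then have "B / q ^ d + M = B" by simp
    moreover have "0 \<le> B" using qd M by (simp add: B_def)
    ultimately have B: "B / q ^ d + M = B" "0 \<le> B" by auto
    have finN: "finite (N T)" for T by (rule finite_subset[OF _ fin[of T]]) (auto simp: N_def)
    have N_le: "0 < T \<Longrightarrow> T \<le> R * q ^ j \<Longrightarrow> real (card (N T)) \<le> B * T ^ d" for j T
    proof (induction j arbitrary: T)
      case 0
      then have "N T = {}" by (auto simp: N_def)
      then show ?case using B 0 by simp
    next
      case (Suc j)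
      show ?case
      proof (cases "T < R")
        case True
        then have "N T = {}" by (auto simp: N_def)
        then show ?thesis using B Suc by simp
      next
        case False
        let ?A = "{n. p \<le> n \<and> 1 \<le> n \<and> T / q < c n \<and> c n \<le> T}"
        have "finite ?A" by (rule finite_subset[OF _ fin[of T]]) auto
        have "N T \<subseteq> N (T / q) \<union> ?A" by (auto simp: N_def)
        then have "card (N T) \<le> card (N (T / q) \<union> ?A)"
          using \<open>finite ?A\<close> finN by (intro card_mono) auto
        also have "\<dots> \<le> card (N (T / q)) + card ?A" by (rule card_Un_le)
        finally have "real (card (N T)) \<le> real (card (N (T / q))) + real (card ?A)" by linarith
        also have "\<dots> \<le> B * (T / q) ^ d + M * T ^ d"
          using Suc.prems q False by (intro add_mono Suc.IH sparse) (auto simp: field_simps)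
        also have "\<dots> = (B / q ^ d + M) * T ^ d"
          by (simp add: power_divide algebra_simps)
        finally show ?thesis by (simp only: B)
      qed
    qed
    \<comment> \<open>The finitely many remaining terms are absorbed into the constant, because all terms are at least
      some \<open>\<delta> > 0\<close>.\<close>
    define F where "F = {n. 1 \<le> n \<and> (n < p \<or> c n \<le> R)}"
    have finF: "finite F"
      by (rule finite_subset[OF _ finite_UnI[OF finite_lessThan[of p] fin[of R]]]) (auto simp: F_def)
    have "finite (c ` {n. 1 \<le> n \<and> c n \<le> c 1})" using fin by simp
    define \<delta> where "\<delta> = Min (c ` {n. 1 \<le> n \<and> c n \<le> c 1})"
    have \<delta>_in: "\<delta> \<in> c ` {n. 1 \<le> n \<and> c n \<le> c 1}"
      unfolding \<delta>_def using fin by (intro Min_in) auto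
    then have \<delta>0: "0 < \<delta>" using c_pos by auto
    have \<delta>_le: "\<delta> \<le> c n" if "1 \<le> n" for n
    proof (cases "c n \<le> c 1")
      case True
      then show ?thesis unfolding \<delta>_def using fin that by (intro Min_le) auto
    next
      case False
      then show ?thesis using \<delta>_in by auto
    qed
    obtain n where n: "1 \<le> n" and
      big: "(real (card F) / \<delta> ^ d + B) * c n ^ d < real (card {m. 1 \<le> m \<and> c m \<le> c n})"
      using growth by blast
    have cn: "0 < c n" using c_pos n by simp
    obtain j where "c n / R < q ^ j" using real_arch_pow[OF q] by blast
    then have j: "c n \<le> R * q ^ j" using R by (simp add: field_simps)
    have "{m. 1 \<le> m \<and> c m \<le> c n} \<subseteq> F \<union> N (c n)" by (auto simp: F_def N_def)
    then have "card {m. 1 \<le> m \<and> c m \<le> c n} \<le> card (F \<union> N (c n))"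
      using finF finN by (intro card_mono) auto
    also have "\<dots> \<le> card F + card (N (c n))" by (rule card_Un_le)
    finally have "real (card {m. 1 \<le> m \<and> c m \<le> c n}) \<le> real (card F) + real (card (N (c n)))" by linarith
    also have "\<dots> \<le> real (card F) + B * c n ^ d" using N_le[OF cn j] by simp
    finally have "real (card {m. 1 \<le> m \<and> c m \<le> c n}) \<le> real (card F) + B * c n ^ d" .
    moreover have "1 \<le> c n ^ d / \<delta> ^ d" using \<delta>_le[OF n] \<delta>0 by (simp add: power_mono)
    then have "real (card F) * 1 \<le> real (card F) * (c n ^ d / \<delta> ^ d)" by (rule mult_left_mono) simp
    ultimately show False using big by (simp add: algebra_simps)
  qed
  then show ?thesis using that by blast
qed

section \<open>Catching the points of an annulus\<close>

text \<open>The tent is at least \<open>1\<close> on the shell of relative half-thickness \<open>t\<close> around the sphere of radius \<open>y\<close> and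
vanishes off the shell of relative half-thickness \<open>2 * t\<close>. What matters is that the bound is linear in \<open>t\<close>:
doubling the number of available dilations halves the cost.\<close>

lemma spherical_tent_integral:
  fixes y t :: real
  defines "g \<equiv> \<lambda>x::'a::euclidean_space. max 0 (2 - \<bar>norm x - y\<bar> / (y * t))"
  assumes y: "0 < y" and t: "0 < t" "t \<le> 1/2"
  shows "integrable lborel g"
    and "integral\<^sup>L lborel g \<le> 4 * unit_ball_vol DIM('a) * 2 ^ DIM('a) * DIM('a) * t * y ^ DIM('a)"
proof -
  let ?d = "DIM('a)"
  define S :: "'a set" where "S = cball 0 (y * (1 + 2 * t)) - ball 0 (y * (1 - 2 * t))"
  have yt: "0 < y * t" using y t by simp
  have g0: "0 \<le> g x" for x by (simp add: g_def)
  have g_le: "g x \<le> 2 * indicator S x" for x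
  proof (cases "x \<in> S")
    case True
    have "0 \<le> \<bar>norm x - y\<bar> / (y * t)" using yt by simp
    then show ?thesis using True by (simp add: g_def)
  next
    case False
    then have "2 * (y * t) \<le> \<bar>norm x - y\<bar>"
      by (auto simp: S_def algebra_simps)
    then have "2 \<le> \<bar>norm x - y\<bar> / (y * t)" using yt by (simp add: field_simps)
    then show ?thesis using False by (simp add: g_def)
  qed
  have S_sets: "S \<in> sets lborel" by (simp add: S_def)
  have "emeasure lborel S \<le> emeasure lborel (cball (0::'a) (y * (1 + 2 * t)))"
    by (rule emeasure_mono) (auto simp: S_def)
  then have S_fin: "emeasure lborel S < \<infinity>"
    using emeasure_lborel_cball_finite[of "0::'a"] by (metis infinity_ennreal_def order_le_less_trans)
  have S_int: "integrable lborel (\<lambda>x. 2 * indicator S x :: real)"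
    using S_sets S_fin by (intro integrable_mult_right integrable_real_indicator)
  have "continuous_on UNIV g" unfolding g_def using yt by (intro continuous_intros) auto
  then have "g \<in> borel_measurable lborel" using borel_measurable_continuous_onI by simp
  then show int: "integrable lborel g"
    by (rule Bochner_Integration.integrable_bound[OF S_int]) (use g0 g_le in auto)
  have "measure lborel S = measure lborel (cball (0::'a) (y * (1 + 2 * t))) - measure lborel (ball (0::'a) (y * (1 - 2 * t)))"
    unfolding S_def
  proof (rule measure_Diff)
    have "y * (1 - 2 * t) \<le> y * (1 + 2 * t)" using y t by (intro mult_left_mono) auto
    then show "ball (0::'a) (y * (1 - 2 * t)) \<subseteq> cball 0 (y * (1 + 2 * t))" by auto
    show "emeasure lborel (cball (0::'a) (y * (1 + 2 * t))) \<noteq> \<infinity>"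
      using emeasure_lborel_cball_finite[of "0::'a" "y * (1 + 2 * t)"] by simp
  qed auto
  also have "\<dots> = unit_ball_vol ?d * (y * (1 + 2 * t)) ^ ?d - unit_ball_vol ?d * (y * (1 - 2 * t)) ^ ?d"
    using y t by (simp add: content_cball content_ball)
  \<comment> \<open>Halving both radii brings them into the unit interval, where \<open>norm_power_diff\<close> applies.\<close>
  also have "\<dots> = unit_ball_vol ?d * y ^ ?d * 2 ^ ?d * ((1/2 + t) ^ ?d - (1/2 - t) ^ ?d)"
  proof -
    have "1 + 2 * t = 2 * (1/2 + t)" "1 - 2 * t = 2 * (1/2 - t)" by auto
    then show ?thesis by (simp only: power_mult_distrib) (simp add: algebra_simps)
  qed
  also have "\<dots> \<le> unit_ball_vol ?d * y ^ ?d * 2 ^ ?d * (?d * (2 * t))"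
  proof (rule mult_left_mono)
    have "norm ((1/2 + t) ^ ?d - (1/2 - t) ^ ?d) \<le> ?d * norm ((1/2 + t) - (1/2 - t))"
      using t by (intro norm_power_diff) auto
    then show "(1/2 + t) ^ ?d - (1/2 - t) ^ ?d \<le> ?d * (2 * t)" using t by simp
  qed (use y in simp)
  finally have meas: "measure lborel S \<le> unit_ball_vol ?d * y ^ ?d * 2 ^ ?d * (?d * (2 * t))" .
  have "integral\<^sup>L lborel g \<le> integral\<^sup>L lborel (\<lambda>x. 2 * indicator S x :: real)"
    by (intro integral_mono int S_int g_le)
  also have "\<dots> = 2 * measure lborel S" by simp
  also have "\<dots> \<le> 4 * unit_ball_vol ?d * 2 ^ ?d * ?d * t * y ^ ?d"
    using meas by (simp add: algebra_simps)
  finally show "integral\<^sup>L lborel g \<le> 4 * unit_ball_vol ?d * 2 ^ ?d * ?d * t * y ^ ?d" .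
qed

text \<open>One step of the construction: the multipliers with indices in \<open>{p..<p'}\<close>, after a relative perturbation
of at most \<open>\<epsilon>\<close>, move every point of the annulus \<open>1 / K \<le> norm x \<le> K\<close> to a place where \<open>g\<close> is at least \<open>1\<close>,
at the price of an integral of at most \<open>\<delta>\<close>. That \<open>g\<close> vanishes near the origin makes the sum of the functions
of infinitely many steps locally finite.\<close>

definition catching_block ::
  "(nat \<Rightarrow> real) \<Rightarrow> real \<Rightarrow> real \<Rightarrow> real \<Rightarrow> nat \<Rightarrow> nat \<Rightarrow> (nat \<Rightarrow> real) \<Rightarrow> ('a::euclidean_space \<Rightarrow> real) \<Rightarrow> bool"
where
  "catching_block c \<epsilon> \<delta> K p p' \<beta> g \<longleftrightarrow>
     p < p' \<and> (\<forall>n\<in>{p..<p'}. 0 < \<beta> n \<and> \<bar>\<beta> n / c n - 1\<bar> \<le> \<epsilon>) \<and>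
     continuous_on UNIV g \<and> (\<forall>x. 0 \<le> g x) \<and> (\<forall>x. norm x < K \<longrightarrow> g x = 0) \<and>
     integrable lborel g \<and> integral\<^sup>L lborel g \<le> \<delta> \<and>
     (\<forall>x. 1 / K \<le> norm x \<and> norm x \<le> K \<longrightarrow> (\<exists>n\<in>{p..<p'}. 1 \<le> g (\<beta> n *\<^sub>R x)))"

text \<open>The annulus is cut into thinner annuli with radii \<open>q ^ l / K\<close>, where \<open>q = 1 + \<epsilon>\<close>. Each has its own
spherical tent, of radius \<open>y l = T * q ^ l / K\<close>, and the same \<open>m\<close> evenly spread multipliers
\<open>T / (1 + i * \<epsilon> / m)\<close> serve them all: they cover the whole ratio \<open>q\<close> between consecutive radii.\<close>

lemma catching_block_exists:
  fixes c :: "nat \<Rightarrow> real"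
  assumes c_pos: "\<And>n. 1 \<le> n \<Longrightarrow> 0 < c n"
    and fin: "\<And>R. finite {n. 1 \<le> n \<and> c n \<le> R}"
    and growth: "\<And>C. \<exists>n\<ge>1. C * c n ^ DIM('a::euclidean_space) < real (card {m. 1 \<le> m \<and> c m \<le> c n})"
    and \<epsilon>: "0 < \<epsilon>" "\<epsilon> \<le> 1/4" and \<delta>: "0 < \<delta>" and K: "1 \<le> K" and p: "1 \<le> p"
  shows "\<exists>p' \<beta> (g :: 'a \<Rightarrow> real). catching_block c \<epsilon> \<delta> K p p' \<beta> g"
proof -
  let ?d = "DIM('a)"
  define q where "q = 1 + \<epsilon>"
  have q: "1 < q" using \<epsilon> by (simp add: q_def)
  obtain L where L: "K\<^sup>2 < q ^ L" using real_arch_pow[OF q] by blast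
  define A where "A = 4 * unit_ball_vol ?d * 2 ^ ?d * ?d * \<epsilon>"
  have A: "0 \<le> A" using \<epsilon> by (simp add: A_def)
  define Y where "Y = q ^ L"
  have Y: "0 < Y" using q by (simp add: Y_def)
  \<comment> \<open>\<open>A / m * (T * Y) ^ d\<close> will bound the integral of each of the \<open>L\<close> tents, and \<open>m \<ge> M * T ^ d\<close>; so this \<open>M\<close>
    makes the total at most \<open>\<delta>\<close>. The summand \<open>1\<close> ensures \<open>m > 0\<close>.\<close>
  define M where "M = L * A * Y ^ ?d / \<delta> + 1"
  have M: "1 \<le> M" using A Y \<delta> by (simp add: M_def)
  obtain T where T: "2 * K * K \<le> T" and
    crowd: "M * T ^ ?d < real (card {n. p \<le> n \<and> 1 \<le> n \<and> T / q < c n \<and> c n \<le> T})"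
    by (rule crowded_ratio_interval[where c = c and q = q and R = "2 * K * K" and M = M and p = p and d = ?d])
       (use c_pos fin growth q K M in auto)
  define I where "I = {n. p \<le> n \<and> 1 \<le> n \<and> T / q < c n \<and> c n \<le> T}"
  define m where "m = card I"
  have T0: "0 < T" using T K by (smt (verit) mult_pos_pos)
  have m_big: "M * T ^ ?d < real m" using crowd by (simp add: m_def I_def)
  have "0 < M * T ^ ?d" using M T0 by simp
  then have m: "0 < m" using m_big by simp
  then have finI: "finite I" unfolding m_def by (simp add: card_gt_0_iff)
  define t where "t = \<epsilon> / m"
  have "t \<le> \<epsilon> / 1" unfolding t_def using m \<epsilon> by (intro divide_left_mono) auto
  then have t: "0 < t" "t \<le> 1/4" using m \<epsilon> by (auto simp: t_def)
  have tm: "t * m = \<epsilon>" using m by (simp add: t_def)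
  obtain h where h: "bij_betw h I {0..<m}"
    using ex_bij_betw_finite_nat[OF finI] by (auto simp: m_def)
  define \<beta> where "\<beta> n = (if n \<in> I then T / (1 + h n * t) else c n)" for n
  define y where "y l = T / K * q ^ l" for l
  have y_ge: "2 * K \<le> y l" for l
  proof -
    have "2 * K \<le> T / K" using T K by (simp add: field_simps)
    also have "\<dots> * 1 \<le> T / K * q ^ l" using T0 K q by (intro mult_left_mono one_le_power) auto
    finally show ?thesis by (simp add: y_def)
  qed
  have y0: "0 < y l" for l using y_ge[of l] K by simp
  have y_le: "y l \<le> T * Y" if "l < L" for l
  proof -
    have "T / K * q ^ l \<le> T * q ^ L"
      using T0 K q that by (intro mult_mono power_increasing) (auto simp: field_simps)
    then show ?thesis by (simp add: y_def Y_def)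
  qed
  define g where "g x = (\<Sum>l<L. max 0 (2 - \<bar>norm x - y l\<bar> / (y l * t)))" for x :: 'a
  have "t \<le> 1/2" using t by simp
  note tent = spherical_tent_integral[where 'a = 'a, OF y0 t(1) this]
  have g_ge: "max 0 (2 - \<bar>norm x - y l\<bar> / (y l * t)) \<le> g x" if "l < L" for l x
    unfolding g_def using that by (intro member_le_sum) auto
  have c1: "continuous_on UNIV g"
    unfolding g_def using y0 t by (intro continuous_intros) (auto simp: less_imp_neq[symmetric])
  have c2: "0 \<le> g x" for x by (auto simp: g_def intro: sum_nonneg)
  have c3: "g x = 0" if "norm x < K" for x
  proof (unfold g_def, intro sum.neutral ballI)
    fix l
    have "2 * (y l * t) \<le> y l / 2" using y0[of l] t by (simp add: field_simps)
    also have "\<dots> \<le> \<bar>norm x - y l\<bar>" using y_ge[of l] that by linarith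
    finally have "2 \<le> \<bar>norm x - y l\<bar> / (y l * t)" using y0[of l] t by (simp add: field_simps)
    then show "max 0 (2 - \<bar>norm x - y l\<bar> / (y l * t)) = 0" by simp
  qed
  have c4: "integrable lborel g" unfolding g_def by (intro Bochner_Integration.integrable_sum tent)
  have c5: "integral\<^sup>L lborel g \<le> \<delta>"
  proof -
    have "integral\<^sup>L lborel g = (\<Sum>l<L. \<integral>x. max 0 (2 - \<bar>norm (x::'a) - y l\<bar> / (y l * t)) \<partial>lborel)"
      unfolding g_def by (intro Bochner_Integration.integral_sum tent)
    also have "\<dots> \<le> (\<Sum>l<L. A / m * (T * Y) ^ ?d)"
    proof (rule sum_mono)
      fix l assume "l \<in> {..<L}"
      then have "y l ^ ?d \<le> (T * Y) ^ ?d" using y_le y0[of l] by (intro power_mono) auto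
      then have "A / m * y l ^ ?d \<le> A / m * (T * Y) ^ ?d" using A by (intro mult_left_mono) auto
      then show "(\<integral>x. max 0 (2 - \<bar>norm (x::'a) - y l\<bar> / (y l * t)) \<partial>lborel) \<le> A / m * (T * Y) ^ ?d"
        using tent(2)[of l] by (simp add: A_def t_def)
    qed
    also have "\<dots> = (L * A * Y ^ ?d) * T ^ ?d / m" by (simp add: power_mult_distrib)
    also have "\<dots> \<le> (\<delta> * M) * T ^ ?d / m"
    proof -
      have "L * A * Y ^ ?d \<le> \<delta> * M" using \<delta> by (simp add: M_def field_simps)
      then show ?thesis using T0 by (intro divide_right_mono mult_right_mono) auto
    qed
    also have "\<dots> \<le> \<delta>"
    proof -
      have "\<delta> * (M * T ^ ?d) \<le> \<delta> * m" using m_big \<delta> by (intro mult_left_mono) auto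
      then show ?thesis using m by (simp add: field_simps)
    qed
    finally show ?thesis .
  qed
  have \<beta>_close: "0 < \<beta> n \<and> \<bar>\<beta> n / c n - 1\<bar> \<le> \<epsilon>" if "1 \<le> n" for n
  proof (cases "n \<in> I")
    case False
    then show ?thesis using c_pos[OF that] \<epsilon> by (simp add: \<beta>_def)
  next
    case True
    define s where "s = 1 + h n * t"
    have "h n < m" using bij_betwE[OF h] True by auto
    then have "h n * t \<le> m * t" using t by (intro mult_right_mono) auto
    then have s: "1 \<le> s" "s \<le> q" using tm t by (auto simp: s_def q_def mult.commute)
    have cn: "T / q < c n" "c n \<le> T" "0 < c n" using True c_pos that by (auto simp: I_def)
    have "T < q * c n" using cn q by (simp add: field_simps)
    also have "\<dots> \<le> (1 + \<epsilon>) * (s * c n)" using s cn q by (simp add: q_def)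
    finally have "T / s / c n \<le> 1 + \<epsilon>" using s cn by (simp add: field_simps)
    moreover have "1 - \<epsilon> \<le> T / s / c n"
    proof -
      have "(1 - \<epsilon>) * (s * c n) \<le> (1 - \<epsilon>) * (q * T)"
        using s cn \<epsilon> q by (intro mult_left_mono mult_mono) auto
      also have "\<dots> = T - \<epsilon>\<^sup>2 * T" by (simp add: q_def power2_eq_square algebra_simps)
      also have "\<dots> \<le> T" using T0 by simp
      finally show ?thesis using s cn by (simp add: field_simps)
    qed
    moreover have "\<beta> n = T / s" using True by (simp add: \<beta>_def s_def)
    ultimately show ?thesis using T0 s by (auto simp: abs_le_iff)
  qed
  have c6: "\<exists>n\<in>I. 1 \<le> g (\<beta> n *\<^sub>R x)" if x: "1 / K \<le> norm x" "norm x \<le> K" for x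
  proof -
    let ?r = "norm x"
    have upper: "?r < 1 / K * q ^ L"
    proof -
      have "?r * K \<le> K * K" using x K by (intro mult_right_mono) auto
      then have "?r * K < q ^ L" using L by (simp add: power2_eq_square)
      then show ?thesis using K by (simp add: field_simps)
    qed
    define j where "j = (LEAST j. ?r < 1 / K * q ^ j)"
    have j: "?r < 1 / K * q ^ j" unfolding j_def by (rule LeastI[of _ L]) (rule upper)
    have "j \<le> L" unfolding j_def by (rule Least_le) (rule upper)
    have "j \<noteq> 0" using j x by (intro notI) simp
    then obtain l where l: "j = Suc l" using not0_implies_Suc by blast
    have "\<not> ?r < 1 / K * q ^ l" using not_less_Least[of l "\<lambda>j. ?r < 1 / K * q ^ j"] l unfolding j_def by simp
    define \<rho> where "\<rho> = 1 / K * q ^ l"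
    have \<rho>: "0 < \<rho>" "\<rho> \<le> ?r" "?r < \<rho> * q"
      using K q j l \<open>\<not> ?r < 1 / K * q ^ l\<close> by (auto simp: \<rho>_def mult_ac)
    have y: "y l = T * \<rho>" by (simp add: y_def \<rho>_def)
    have "l < L" using \<open>j \<le> L\<close> l by simp
    \<comment> \<open>Relative position of \<open>x\<close> in its thin annulus, in units of the grid width. Rounding down gives the
      multiplier, and the strict bound \<open>?r < \<rho> * q\<close> keeps the rounded value below \<open>m\<close>.\<close>
    define u where "u = (?r / \<rho> - 1) / t"
    have u0: "0 \<le> u" using \<rho> t by (simp add: u_def)
    have "?r / \<rho> - 1 < \<epsilon>" using \<rho> by (simp add: field_simps q_def)
    then have um: "u < m" using t tm by (simp add: u_def field_simps)
    define i where "i = nat \<lfloor>u\<rfloor>"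
    have i: "real i \<le> u" "u < real i + 1" using u0 by (auto simp: i_def)
    have "i < m" using i um by simp
    then obtain n where n: "n \<in> I" "h n = i" using h unfolding bij_betw_def
      by (metis atLeast0LessThan image_iff lessThan_iff)
    define s where "s = 1 + i * t"
    have s: "1 \<le> s" using t by (simp add: s_def)
    have r: "?r = \<rho> * (1 + u * t)" using \<rho> t by (simp add: u_def field_simps)
    have "norm (\<beta> n *\<^sub>R x) - y l = T / s * ?r - T * \<rho>"
      using n s T0 by (simp add: \<beta>_def s_def y)
    also have "\<dots> = (T * \<rho>) * (((u - i) * t) / s)" using s by (simp add: r s_def field_simps)
    finally have diff: "norm (\<beta> n *\<^sub>R x) - y l = y l * (((u - i) * t) / s)" by (simp add: y)
    have "(u - i) * t \<le> 1 * t" using i t by (intro mult_right_mono) auto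
    also have "\<dots> \<le> t * s" using s t by simp
    finally have "((u - i) * t) / s \<le> t" using s by (simp add: field_simps)
    moreover have "0 \<le> ((u - i) * t) / s" using i t s by simp
    ultimately have "\<bar>norm (\<beta> n *\<^sub>R x) - y l\<bar> \<le> y l * t"
      unfolding diff using y0[of l] by (simp only: abs_mult abs_of_pos abs_of_nonneg mult_le_cancel_left_pos)
    then have "\<bar>norm (\<beta> n *\<^sub>R x) - y l\<bar> / (y l * t) \<le> 1" using y0[of l] t by (simp add: field_simps)
    then have "1 \<le> g (\<beta> n *\<^sub>R x)" using g_ge[OF \<open>l < L\<close>, of "\<beta> n *\<^sub>R x"] by linarith
    with n show ?thesis by blast
  qed
  have "I \<noteq> {}" using m by (auto simp: m_def)
  have I_sub: "I \<subseteq> {p..<Suc (Max I)}" using finI by (auto simp: I_def less_Suc_eq_le)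
  then have "p < Suc (Max I)" using \<open>I \<noteq> {}\<close> by fastforce
  then have "catching_block c \<epsilon> \<delta> K p (Suc (Max I)) \<beta> g"
    unfolding catching_block_def using \<beta>_close p c1 c2 c3 c4 c5 c6 I_sub by (meson atLeastLessThan_iff order_trans subsetD)
  then show ?thesis by blast
qed

section \<open>Assembling the blocks\<close>

text \<open>Block \<open>k\<close> uses \<open>\<epsilon> = 1 / (k + 4)\<close>, \<open>\<delta> = 1 / 2 ^ k\<close> and \<open>K = k + 1\<close>, and starts where block \<open>k - 1\<close> ends. Every
index then belongs to exactly one block, so \<open>b\<close> is well defined and \<open>b n / c n\<close> tends to \<open>1\<close>, while
each \<open>x \<noteq> 0\<close> lies in the annuli of all but finitely many blocks.\<close>

lemma assemble_catching_blocks: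
  fixes c :: "nat \<Rightarrow> real" and f0 :: "'a::euclidean_space \<Rightarrow> real"
  assumes c_pos: "\<And>n. 1 \<le> n \<Longrightarrow> 0 < c n"
    and blocks: "\<And>\<epsilon> \<delta> K p. 0 < \<epsilon> \<Longrightarrow> \<epsilon> \<le> 1/4 \<Longrightarrow> 0 < \<delta> \<Longrightarrow> 1 \<le> K \<Longrightarrow> 1 \<le> p \<Longrightarrow>
      \<exists>p' \<beta> (g :: 'a \<Rightarrow> real). catching_block c \<epsilon> \<delta> K p p' \<beta> g"
    and f0: "continuous_on UNIV f0" "\<And>x. 0 < f0 x" "integrable lborel f0"
  shows "\<exists>b (f :: 'a \<Rightarrow> real). (\<forall>n\<ge>1. 0 < b n) \<and> continuous_on UNIV f \<and> (\<forall>x. 0 \<le> f x) \<and>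
    integrable lborel f \<and> (\<lambda>n. b n / c n) \<longlonglongrightarrow> 1 \<and> (\<forall>x. \<not> (\<lambda>n. f (b n *\<^sub>R x)) \<longlonglongrightarrow> 0)"
proof -
  define bl :: "nat \<Rightarrow> nat \<Rightarrow> nat \<Rightarrow> (nat \<Rightarrow> real) \<Rightarrow> ('a \<Rightarrow> real) \<Rightarrow> bool"
    where "bl k = catching_block c (1 / (real k + 4)) ((1/2)^k) (real k + 1)" for k
  have "\<exists>p' \<beta> (g :: 'a \<Rightarrow> real). bl k (Suc p) p' \<beta> g" for k p
    unfolding bl_def by (rule blocks) (auto simp: field_simps)
  then obtain p' \<beta> and g :: "nat \<Rightarrow> nat \<Rightarrow> 'a \<Rightarrow> real"
    where block: "\<And>k p. bl k (Suc p) (p' k p) (\<beta> k p) (g k p)"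
    by metis
  define P where "P = rec_nat 1 (\<lambda>k p. p' k (p - 1))"
  have P_0: "P 0 = 1" and P_Suc: "P (Suc k) = p' k (P k - 1)" for k by (simp_all add: P_def)
  have P1: "1 \<le> P k" for k
  proof (induction k)
    case (Suc k)
    have "Suc (P k - 1) < p' k (P k - 1)"
      using block[of k "P k - 1"] by (simp add: bl_def catching_block_def)
    then show ?case by (simp add: P_Suc)
  qed (simp add: P_0)
  define B where "B k = \<beta> k (P k - 1)" for k
  define G where "G k = g k (P k - 1)" for k
  have "bl k (P k) (P (Suc k)) (B k) (G k)" for k
    using block[of k "P k - 1"] P1[of k] by (simp add: P_Suc B_def G_def)
  note blk = this[unfolded bl_def catching_block_def]
  have P_mono: "strict_mono P" using blk by (intro strict_monoI_Suc) blast
  have P_ge: "k \<le> P k" for k using P_mono by (rule strict_mono_imp_increasing)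
  \<comment> \<open>The block to which an index belongs.\<close>
  define stage where "stage n = (LEAST k. n < P (Suc k))" for n
  have stage: "n \<in> {P (stage n)..<P (Suc (stage n))}" if "1 \<le> n" for n
  proof -
    have 1: "n < P (Suc (stage n))"
      unfolding stage_def by (rule LeastI[of _ n]) (use P_ge[of "Suc n"] in simp)
    have "P (stage n) \<le> n"
    proof (cases "stage n")
      case (Suc k)
      then have "\<not> n < P (Suc k)" using not_less_Least[of k "\<lambda>k. n < P (Suc k)"] by (simp add: stage_def)
      then show ?thesis using Suc by simp
    qed (use that P_0 in simp)
    then show ?thesis using 1 by simp
  qed
  have stage_eq: "stage n = k" if "n \<in> {P k..<P (Suc k)}" for n k
    unfolding stage_def
  proof (rule Least_equality)
    fix j assume "n < P (Suc j)"
    then have "P k < P (Suc j)" using that by simp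
    then show "k \<le> j" using P_mono by (simp add: strict_mono_less less_Suc_eq_le)
  qed (use that in simp)
  define b where "b n = B (stage n) n" for n
  have b: "0 < b n" "\<bar>b n / c n - 1\<bar> \<le> 1 / (real (stage n) + 4)" if "1 \<le> n" for n
    using blk[of "stage n"] stage[OF that] by (auto simp: b_def)
  have stage_large: "k \<le> stage n" if "P k \<le> n" for k n
  proof -
    have "n < P (Suc (stage n))" using stage[of n] that P1[of k] by simp
    then have "P k < P (Suc (stage n))" using that by simp
    then show ?thesis using P_mono by (simp add: strict_mono_less less_Suc_eq_le)
  qed
  have lim: "(\<lambda>n. b n / c n) \<longlonglongrightarrow> 1"
  proof (rule LIMSEQ_I)
    fix r :: real assume r: "0 < r"
    obtain k where k: "1 / r < real k" using reals_Archimedean2 by blast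
    have "norm (b n / c n - 1) < r" if "P k \<le> n" for n
    proof -
      have "1 / r < real (stage n) + 4" using k stage_large[OF that] by simp
      then have "1 / (real (stage n) + 4) < r" using r by (simp add: field_simps)
      then show ?thesis using b(2)[of n] that P1[of k] by simp
    qed
    then show "\<exists>no. \<forall>n\<ge>no. norm (b n / c n - 1) < r" by blast
  qed
  have G0: "0 \<le> G k x" for k x using blk by blast
  have G_supp: "G k x = 0" if "norm x < real k + 1" for k x using blk that by blast
  have G_int: "integrable lborel (G k)" for k using blk by blast
  have G_integral: "integral\<^sup>L lborel (G k) \<le> (1/2)^k" for k using blk by blast
  define S where "S x = (\<Sum>k. G k x)" for x
  have sums: "(\<lambda>k. G k x) sums (\<Sum>k<N. G k x)" if "norm x < real N" for x N
    using that by (intro sums_finite) (auto intro!: G_supp)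
  have summ: "summable (\<lambda>k. G k x)" for x
    using sums reals_Archimedean2[of "norm x"] by (blast intro: sums_summable)
  have S_eq: "S x = (\<Sum>k<N. G k x)" if "norm x < real N" for x N
    unfolding S_def using sums[OF that] by (rule sums_unique[symmetric])
  \<comment> \<open>On the ball of radius \<open>N\<close>, the series is the finite sum of its first \<open>N\<close> terms.\<close>
  have S_cont: "continuous_on UNIV S"
  proof (rule continuous_at_imp_continuous_on, rule ballI)
    fix x :: 'a
    obtain N where N: "norm x < real N" using reals_Archimedean2 by blast
    have "continuous_on (ball 0 (real N)) (\<lambda>x. \<Sum>k<N. G k x)"
      using blk by (intro continuous_on_sum) (blast intro: continuous_on_subset)
    then have "continuous_on (ball 0 (real N)) S"
      by (rule continuous_on_eq) (simp add: S_eq)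
    then show "isCont S x" using N by (simp add: continuous_on_eq_continuous_at)
  qed
  have S0: "0 \<le> S x" for x unfolding S_def by (rule suminf_nonneg[OF summ G0])
  have S_ge: "G k x \<le> S x" for k x
    unfolding S_def using sum_le_suminf[OF summ, of "{k}" x] G0 by simp
  have S_int: "integrable lborel S"
    unfolding S_def
  proof (rule integrable_suminf[OF G_int])
    show "AE x in lborel. summable (\<lambda>k. norm (G k x))" using summ G0 by auto
    have half: "summable (\<lambda>k. (1/2::real)^k)" by (simp add: summable_geometric)
    show "summable (\<lambda>k. \<integral>x. norm (G k x) \<partial>lborel)"
      by (rule summable_comparison_test'[OF half, of 0]) (use G0 G_integral in \<open>auto simp: integral_nonneg_AE\<close>)
  qed
  define f where "f x = f0 x + S x" for x
  have no_lim: "\<not> (\<lambda>n. f (b n *\<^sub>R x)) \<longlonglongrightarrow> 0" for x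
  proof
    assume lim0: "(\<lambda>n. f (b n *\<^sub>R x)) \<longlonglongrightarrow> 0"
    show False
    proof (cases "x = 0")
      case True
      then have "f 0 = 0" using lim0 by (simp add: LIMSEQ_const_iff)
      then show False using f0(2)[of 0] S0[of 0] by (simp add: f_def)
    next
      case False
      obtain N where N: "\<And>n. N \<le> n \<Longrightarrow> norm (f (b n *\<^sub>R x)) < 1"
        using LIMSEQ_D[OF lim0, of 1] by auto
      obtain k1 where k1: "norm x < real k1" using reals_Archimedean2 by blast
      obtain k2 where k2: "1 / norm x < real k2" using reals_Archimedean2 by blast
      define k where "k = max N (max k1 k2)"
      have "norm x \<le> real k + 1" using k1 by (simp add: k_def)
      moreover have "1 / norm x < real k + 1" using k2 by (simp add: k_def)
      then have "1 / (real k + 1) \<le> norm x" using False by (simp add: field_simps)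
      ultimately obtain n where n: "n \<in> {P k..<P (Suc k)}" "1 \<le> G k (B k n *\<^sub>R x)"
        using blk by blast
      have "N \<le> n" using n P_ge[of k] by (simp add: k_def)
      have "b n = B k n" using stage_eq[OF n(1)] by (simp add: b_def)
      then have "1 \<le> S (b n *\<^sub>R x)" using n S_ge[of k "b n *\<^sub>R x"] by simp
      then have "1 \<le> f (b n *\<^sub>R x)" using f0(2)[of "b n *\<^sub>R x"] by (simp add: f_def)
      then show False using N[OF \<open>N \<le> n\<close>] by simp
    qed
  qed
  have "continuous_on UNIV f" unfolding f_def by (intro continuous_on_add f0 S_cont)
  moreover have "integrable lborel f" unfolding f_def by (intro Bochner_Integration.integrable_add f0 S_int)
  moreover have "0 \<le> f x" for x using f0(2)[of x] S0[of x] by (simp add: f_def)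
  ultimately show ?thesis using b(1) lim no_lim by blast
qed

section \<open>Sequences with a bounded subsequence, and the conclusion\<close>

lemma not_tendsto_0_if_frequently_bounded:
  fixes f :: "'a::euclidean_space \<Rightarrow> real"
  assumes f: "continuous_on UNIV f" "\<And>x. 0 < f x" and inf: "infinite {n. 1 \<le> n \<and> c n \<le> R}"
    and c_pos: "\<And>n::nat. 1 \<le> n \<Longrightarrow> 0 < c n"
  shows "\<not> (\<lambda>n. f (c n *\<^sub>R x)) \<longlonglongrightarrow> 0"
proof
  assume lim0: "(\<lambda>n. f (c n *\<^sub>R x)) \<longlonglongrightarrow> 0"
  let ?K = "cball (0::'a) (\<bar>R\<bar> * norm x)"
  have "\<exists>z\<in>?K. \<forall>y\<in>?K. f z \<le> f y"
    by (intro continuous_attains_inf continuous_on_subset[OF f(1)]) (auto simp: not_less)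
  then obtain z where z: "\<And>y. y \<in> ?K \<Longrightarrow> f z \<le> f y" by blast
  obtain N where N: "\<And>n. N \<le> n \<Longrightarrow> norm (f (c n *\<^sub>R x)) < f z"
    using LIMSEQ_D[OF lim0 f(2)[of z]] by auto
  obtain n where n: "N \<le> n" "1 \<le> n" "c n \<le> R"
    using inf by (auto simp: infinite_nat_iff_unbounded_le)
  have "c n *\<^sub>R x \<in> ?K" using n c_pos[of n] by (auto intro!: mult_right_mono)
  then show False using z N[OF n(1)] by fastforce
qed

theorem theorem4:
  fixes c :: "nat \<Rightarrow> real"
  assumes c_pos: "\<forall>n\<ge>1. c n > 0"
    and unbdd: "\<forall>c'. is_permutation_of c' c \<longrightarrow>
      \<not> bounded ((\<lambda>n. root CARD('d::finite) (real n) / c' n) ` {1..})"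
  shows "\<exists>(b :: nat \<Rightarrow> real) (f :: real ^ 'd \<Rightarrow> real).
    (\<forall>n\<ge>1. b n > 0) \<and>
    continuous_on UNIV f \<and> (\<forall>x. f x \<ge> 0) \<and> integrable lebesgue f \<and>
    (\<lambda>n. b n / c n) \<longlonglongrightarrow> 1 \<and>
    (\<forall>x. \<not> (\<lambda>n. f (b n *\<^sub>R x)) \<longlonglongrightarrow> 0)"
proof -
  have pos: "0 < c n" if "1 \<le> n" for n using c_pos that by simp
  obtain f0 :: "real ^ 'd \<Rightarrow> real"
    where f0: "continuous_on UNIV f0" "\<And>x. 0 < f0 x" "integrable lborel f0"
    using positive_continuous_integrable_exists by blast
  have "\<exists>b (f :: real ^ 'd \<Rightarrow> real). (\<forall>n\<ge>1. 0 < b n) \<and> continuous_on UNIV f \<and> (\<forall>x. 0 \<le> f x) \<and>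
    integrable lborel f \<and> (\<lambda>n. b n / c n) \<longlonglongrightarrow> 1 \<and> (\<forall>x. \<not> (\<lambda>n. f (b n *\<^sub>R x)) \<longlonglongrightarrow> 0)"
  proof (cases "\<forall>R. finite {n. 1 \<le> n \<and> c n \<le> R}")
    case True
    then have fin: "finite {n. 1 \<le> n \<and> c n \<le> R}" for R by blast
    have growth: "\<exists>n\<ge>1. C * c n ^ DIM(real ^ 'd) < real (card {m. 1 \<le> m \<and> c m \<le> c n})" for C
    proof (rule ccontr)
      assume "\<not> ?thesis"
      then have "\<And>n. 1 \<le> n \<Longrightarrow> real (card {m. 1 \<le> m \<and> c m \<le> c n}) \<le> C * c n ^ CARD('d)"
        by (auto simp: not_less)
      from bounded_permutation_if_sublevel_growth[OF _ pos fin this] show False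
        using unbdd by auto
    qed
    show ?thesis
      by (rule assemble_catching_blocks[OF pos catching_block_exists[OF pos fin growth] f0])
  next
    case False
    then obtain R where R: "infinite {n. 1 \<le> n \<and> c n \<le> R}" by blast
    have "(\<lambda>n. c n / c n) \<longlonglongrightarrow> 1"
      by (rule tendsto_eventually) (use pos in \<open>force simp: eventually_sequentially\<close>)
    moreover have "\<not> (\<lambda>n. f0 (c n *\<^sub>R x)) \<longlonglongrightarrow> 0" for x
      by (rule not_tendsto_0_if_frequently_bounded[OF f0(1,2) R pos])
    ultimately show ?thesis
      using pos f0 by (intro exI[of _ c] exI[of _ f0]) (auto intro: less_imp_le)
  qed
  moreover have "integrable lebesgue f" if "integrable lborel f" for f :: "real ^ 'd \<Rightarrow> real"
    using that by (simp add: integrable_completion borel_measurable_integrable)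
  ultimately show ?thesis by blast
qed

end
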